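(* Let $I(\boldsymbol{B},\boldsymbol{r})$ be a diagonal blockwise determinantal ideal with $\boldsymbol{B}=(B_1,\dots,B_k)$ and $\boldsymbol{r}=(r_1,\dots,r_k)$, let $\mathcal{G}_i$ be the set of all $r_i$-minors in $B_i$ for $i=1,\dots,k$, and let $<$ be a lexicographic diagonal term order induced by a scanning variable order. If for any $G_i\in\mathcal{G}_i$ and $G_j\in\mathcal{G}_j$ with $i\ne j$ the variables appearing in $\mathrm{lt}(G_i)$ are completely different from those appearing in $\mathrm{lt}(G_j)$, then $\bigcup_{i=1}^k\mathcal{G}_i$ is a Gröbner basis of $I(\boldsymbol{B},\boldsymbol{r})$ with respect to $<$.
   Context: Let $K$ be a field and $X=(x_{ij})$ a generic $m\times n$ matrix ($m\le n$) of distinct variables; $K[\boldsymbol{x}]$ is the polynomial ring in all $mn$ variables. A subset of $X$ means a set of entries. An $r$-minor of $X$ is the determinant of an $r\times r$ submatrix (arbitrary row and column index sets of size $r$); it is a minor in a subset $B$ if all entries of the submatrix belong to $B$. $\mathrm{lt}$ denotes the leading term (monomial). A non-empty subset $B$ of $X$ is diagonal if whenever $x_{pq},x_{\tilde p\tilde q}\in B$ with $p\le\tilde p$, $q\le\tilde q$, all $x_{ij}$ with $p\le i\le\tilde p$, $q\le j\le\tilde q$ belong to $B$. For a sequence $\boldsymbol{B}=(B_1,\dots,B_k)$ of non-empty subsets of $X$ (blocks) and a sequence $\boldsymbol{r}=(r_1,\dots,r_k)$ of positive integers, the blockwise determinantal ideal $I(\boldsymbol{B},\boldsymbol{r})\subseteq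 K[\boldsymbol{x}]$ is generated by all $r_i$-minors in $B_i$ for all $i$; it is diagonal when all blocks are diagonal. The scanning variable orders inducing lexicographic diagonal term orders are the four orders in which either the northwest corner $x_{11}$ is the greatest variable and the next greatest variables are determined by scanning row by row to the east (rows top to bottom) or column by column to the south (columns left to right), or the southeast corner $x_{mn}$ is the greatest and one scans row by row to the west (rows bottom to top) or column by column to the north (columns right to left). For such a term order the leading term of every minor is the product of its diagonal entries. It is a known fact, taken as given, that for each $i$ the set $\mathcal{G}_i$ is a Gröbner basis of the ideal it generates with respect to such an order. *)

theory Defs
  imports "HOL-Library.Poly_Mapping" "HOL-Library.Cardinality" "Jordan_Normal_Form.Determinant"
begin

text \<open>
  Monomials in the variables \<open>'v\<close> are finitely supported exponent vectors, polynomials are finitely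
  supported coefficient functions on monomials; multiplication in \<^theory>\<open>HOL-Library.Poly_Mapping\<close>
  is convolution, so for finite \<open>'v\<close> the type \<open>('v, 'k) mpoly\<close> is the polynomial ring \<open>K[x]\<close>.
\<close>

type_synonym 'v mono = "'v \<Rightarrow>\<^sub>0 nat"
type_synonym ('v, 'k) mpoly = "'v mono \<Rightarrow>\<^sub>0 'k"

definition monomial :: "'v mono \<Rightarrow> ('v, 'k::comm_ring_1) mpoly" where
  "monomial t = Poly_Mapping.single t 1"

definition var :: "'v \<Rightarrow> ('v, 'k::comm_ring_1) mpoly" where
  "var x = monomial (Poly_Mapping.single x 1)"

text \<open>Ideals of a commutative ring are the submodules of the ring as a module over itself.\<close>

abbreviation ideal_gen :: "'a::comm_ring_1 set \<Rightarrow> 'a set" where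
  "ideal_gen \<equiv> module.span (*)"

text \<open>
  The entry \<open>x\<^sub>i\<^sub>j\<close> of the generic matrix is identified with its position \<open>(i, j)\<close>. Row and column
  indices come from arbitrary finite linearly ordered types \<open>'m\<close> and \<open>'n\<close>, which play the role of
  \<open>{1, \<dots>, m}\<close> and \<open>{1, \<dots>, n}\<close>; smaller row indices are further north and smaller column indices
  further west.
\<close>

definition minor :: "'m::{finite,linorder} set \<Rightarrow> 'n::{finite,linorder} set \<Rightarrow>
    ('m \<times> 'n, 'k::field) mpoly" where
  "minor I J = det (mat (card I) (card J)
     (\<lambda>(a, b). var (sorted_list_of_set I ! a, sorted_list_of_set J ! b)))"

definition minors_in :: "nat \<Rightarrow> ('m::{finite,linorder} \<times> 'n::{finite,linorder}) set \<Rightarrow>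
    ('m \<times> 'n, 'k::field) mpoly set" where
  "minors_in r B = {minor I J | I J. card I = r \<and> card J = r \<and> I \<times> J \<subseteq> B}"

definition diagonal :: "('m::linorder \<times> 'n::linorder) set \<Rightarrow> bool" where
  "diagonal B \<longleftrightarrow> B \<noteq> {} \<and>
     (\<forall>p q p' q'. (p, q) \<in> B \<and> (p', q') \<in> B \<and> p \<le> p' \<and> q \<le> q' \<longrightarrow>
        (\<forall>i j. p \<le> i \<and> i \<le> p' \<and> q \<le> j \<and> j \<le> q' \<longrightarrow> (i, j) \<in> B))"

definition blockwise_ideal :: "nat \<Rightarrow> (nat \<Rightarrow> ('m::{finite,linorder} \<times> 'n::{finite,linorder}) set) \<Rightarrow>
    (nat \<Rightarrow> nat) \<Rightarrow> ('m \<times> 'n, 'k::field) mpoly set" where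
  "blockwise_ideal k B r = ideal_gen (\<Union>i\<in>{1..k}. minors_in (r i) (B i))"

text \<open>
  Name of a scanning order: the corner holding the greatest variable, and whether the matrix is
  scanned row by row or column by column. \<open>scan_greater s x y\<close> means that \<open>x\<close> is scanned before
  \<open>y\<close>, i.e. that \<open>x\<close> is the greater variable.
\<close>

datatype scan = NW_rows | NW_cols | SE_rows | SE_cols

fun scan_greater :: "scan \<Rightarrow> 'm::linorder \<times> 'n::linorder \<Rightarrow> 'm \<times> 'n \<Rightarrow> bool" where
  "scan_greater NW_rows (i, j) (i', j') \<longleftrightarrow> i < i' \<or> i = i' \<and> j < j'"
| "scan_greater NW_cols (i, j) (i', j') \<longleftrightarrow> j < j' \<or> j = j' \<and> i < i'"
| "scan_greater SE_rows (i, j) (i', j') \<longleftrightarrow> i > i' \<or> i = i' \<and> j > j'"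
| "scan_greater SE_cols (i, j) (i', j') \<longleftrightarrow> j > j' \<or> j = j' \<and> i > i'"

definition lex_less :: "('v \<Rightarrow> 'v \<Rightarrow> bool) \<Rightarrow> 'v mono \<Rightarrow> 'v mono \<Rightarrow> bool" where
  "lex_less gt s t \<longleftrightarrow>
     (\<exists>x. Poly_Mapping.lookup s x < Poly_Mapping.lookup t x \<and>
        (\<forall>y. gt y x \<longrightarrow> Poly_Mapping.lookup s y = Poly_Mapping.lookup t y))"

abbreviation scan_less :: "scan \<Rightarrow> ('m::linorder \<times> 'n::linorder) mono \<Rightarrow> ('m \<times> 'n) mono \<Rightarrow> bool" where
  "scan_less s \<equiv> lex_less (scan_greater s)"

text \<open>
  In the following, \<open>prec\<close> is a strict term order. Leading terms are taken without their
  coefficient, and \<open>lt prec f\<close> is meaningful only for \<open>f \<noteq> 0\<close>.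
\<close>

definition lt :: "('v mono \<Rightarrow> 'v mono \<Rightarrow> bool) \<Rightarrow> ('v, 'k::field) mpoly \<Rightarrow> 'v mono" where
  "lt prec f = (THE t. t \<in> Poly_Mapping.keys f \<and> (\<forall>s\<in>Poly_Mapping.keys f. s \<noteq> t \<longrightarrow> prec s t))"

definition initial_ideal :: "('v mono \<Rightarrow> 'v mono \<Rightarrow> bool) \<Rightarrow> ('v, 'k::field) mpoly set \<Rightarrow>
    ('v, 'k) mpoly set" where
  "initial_ideal prec F = ideal_gen {monomial (lt prec f) | f. f \<in> F \<and> f \<noteq> 0}"

definition groebner_basis :: "('v mono \<Rightarrow> 'v mono \<Rightarrow> bool) \<Rightarrow> ('v, 'k::field) mpoly set \<Rightarrow>
    ('v, 'k) mpoly set \<Rightarrow> bool" where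
  "groebner_basis prec G I \<longleftrightarrow>
     finite G \<and> G \<subseteq> I \<and> initial_ideal prec G = initial_ideal prec I"

end

theory Submission
  imports Defs
begin

text \<open>
  The theorem is an instance of a fact about arbitrary ideals \<open>I\<close> and \<open>J\<close> of a polynomial ring:
  if the leading terms of their Groebner bases \<open>G\<close> and \<open>H\<close> live in disjoint sets of variables, then
  \<open>G \<union> H\<close> is a Groebner basis of \<open>I + J\<close>.

  The reason is that a monomial \<open>t\<close> divisible by coprime monomials \<open>lt g\<close> and \<open>lt h\<close> is divisible by
  their product. Write \<open>f \<in> I + J\<close> as \<open>a + b\<close> with \<open>a \<in> I\<close> and \<open>b \<in> J\<close>, and let \<open>t\<close> be
  the greatest monomial occurring in \<open>a\<close> or \<open>b\<close>. If \<open>t\<close> survives in \<open>a + b\<close>, it is the leading term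
  of \<open>f\<close> and of one of \<open>a\<close> and \<open>b\<close>, so some leading term of \<open>G \<union> H\<close> divides it. If \<open>t\<close> cancels, then it is the leading
  term of both, hence \<open>t = w \<cdot> lt g \<cdot> lt h\<close> with \<open>g \<in> G\<close> and \<open>h \<in> H\<close>. A scalar multiple of
  \<open>w g h \<in> I \<inter> J\<close> can then be moved from \<open>a\<close> to \<open>b\<close> so that \<open>t\<close> disappears from both and
  the greatest monomial drops. This descent terminates because term orders are well-founded
  (\<open>leading_terms_divisible_Un\<close>). Groebner bases of several ideals are joined one at a time, and the
  divisibility statement is translated to equality of initial ideals by
  \<open>groebner_basis_iff_divisible\<close>.
\<close>

section \<open>Ideals and monomials\<close>

interpretation ring_module: Modules.module "(*) :: 'a::comm_ring_1 \<Rightarrow> 'a \<Rightarrow> 'a"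
  by unfold_locales (auto simp: algebra_simps)

lemma ideal_gen_mult:
  fixes p :: "'a::comm_ring_1"
  shows "p \<in> ideal_gen S \<Longrightarrow> q * p \<in> ideal_gen S"
  by (rule ring_module.span_scale)

lemma ideal_gen_mult_right:
  fixes p :: "'a::comm_ring_1"
  shows "p \<in> ideal_gen S \<Longrightarrow> p * q \<in> ideal_gen S"
  using ideal_gen_mult[of p S q] by (simp add: mult.commute)

lemma keys_monomial: "Poly_Mapping.keys (monomial t :: ('v, 'k::field) mpoly) = {t}"
  by (simp add: monomial_def)

lemma monomial_add: "monomial (s + t) = monomial s * monomial t"
  by (simp add: monomial_def mult_single)

text \<open>
  The polynomials all of whose monomials are divisible by an element of \<open>S\<close> form an ideal; this is
  the easy half of the description of monomial ideals.
\<close>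

lemma keys_in_monomial_ideal:
  fixes p :: "('v, 'k::field) mpoly"
  assumes "p \<in> ideal_gen (monomial ` S)" and "t \<in> Poly_Mapping.keys p"
  shows "\<exists>s\<in>S. \<exists>u. t = u + s"
  using assms
proof (induction arbitrary: t rule: ring_module.span_induct_alt)
  case base
  then show ?case by simp
next
  case (step c x y)
  then obtain s where s: "s \<in> S" "x = monomial s" by auto
  consider "t \<in> Poly_Mapping.keys (c * x)" | "t \<in> Poly_Mapping.keys y"
    using step.prems Poly_Mapping.keys_add[of "c * x" y] by blast
  then show ?case
  proof cases
    case 1
    then obtain u v where "t = u + v" "v \<in> Poly_Mapping.keys x"
      using keys_mult[of c x] by blast
    then show ?thesis using s by (auto simp: keys_monomial)
  next
    case 2
    then show ?thesis using step.IH by blast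
  qed
qed

lemma coprime_monomials_divide:
  fixes s t :: "'v mono"
  assumes "r = u + s" "r = v + t"
    and disj: "Poly_Mapping.keys s \<inter> Poly_Mapping.keys t = {}"
  shows "\<exists>w. r = w + (s + t)"
proof
  show "r = (r - (s + t)) + (s + t)"
  proof (rule poly_mapping_eqI)
    fix x
    have "Poly_Mapping.lookup s x = 0 \<or> Poly_Mapping.lookup t x = 0"
      using disj by (auto simp: in_keys_iff)
    moreover have "Poly_Mapping.lookup r x = Poly_Mapping.lookup u x + Poly_Mapping.lookup s x"
      using assms(1) by (simp add: lookup_add)
    moreover have "Poly_Mapping.lookup r x = Poly_Mapping.lookup v x + Poly_Mapping.lookup t x"
      using assms(2) by (simp add: lookup_add)
    ultimately show "Poly_Mapping.lookup r x = Poly_Mapping.lookup (r - (s + t) + (s + t)) x"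
      by (auto simp: lookup_add lookup_minus)
  qed
qed

section \<open>Groebner bases for a term order\<close>

locale term_order =
  fixes prec :: "'v mono \<Rightarrow> 'v mono \<Rightarrow> bool"
  assumes wf_prec: "wfp prec"
    and prec_trans: "prec s t \<Longrightarrow> prec t u \<Longrightarrow> prec s u"
    and prec_total: "s \<noteq> t \<Longrightarrow> prec s t \<or> prec t s"
    and prec_add: "prec s t \<Longrightarrow> prec (u + s) (u + t)"
begin

lemma prec_irrefl: "\<not> prec t t"
  using wf_prec wf_not_refl[of "{(x, y). prec x y}" t] by (simp add: wfp_def)

lemma prec_asym: "prec s t \<Longrightarrow> \<not> prec t s"
  using prec_irrefl[of s] prec_trans[of s t s] by blast

abbreviation bounded_by :: "('v, 'k::field) mpoly \<Rightarrow> 'v mono \<Rightarrow> bool" where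
  "bounded_by f t \<equiv> (\<forall>s\<in>Poly_Mapping.keys f. s \<noteq> t \<longrightarrow> prec s t)"

lemma finite_has_greatest:
  assumes "finite A" "A \<noteq> {}"
  shows "\<exists>t\<in>A. \<forall>s\<in>A. s \<noteq> t \<longrightarrow> prec s t"
  using assms
proof (induction rule: finite_ne_induct)
  case (singleton x)
  then show ?case by simp
next
  case (insert x F)
  then obtain t where t: "t \<in> F" "\<And>s. s \<in> F \<Longrightarrow> s \<noteq> t \<Longrightarrow> prec s t" by blast
  show ?case
  proof (cases "prec t x")
    case True
    have "prec s x" if "s \<in> F" for s
      using t(2)[OF that] True prec_trans[of s t x] by (cases "s = t") auto
    then show ?thesis by blast
  next
    case False
    then have "x \<noteq> t \<longrightarrow> prec x t" using prec_total[of x t] by blast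
    then show ?thesis using t by blast
  qed
qed

lemma lt_eqI:
  assumes "t \<in> Poly_Mapping.keys f" "bounded_by f t"
  shows "lt prec f = t"
  unfolding lt_def
proof (rule the_equality)
  fix s assume s: "s \<in> Poly_Mapping.keys f \<and> bounded_by f s"
  show "s = t"
  proof (rule ccontr)
    assume "s \<noteq> t"
    then have "prec s t" "prec t s" using s assms by simp_all
    then show False using prec_asym by blast
  qed
qed (use assms in blast)

lemma
  assumes "f \<noteq> 0"
  shows lt_in_keys: "lt prec f \<in> Poly_Mapping.keys f"
    and bounded_by_lt: "bounded_by f (lt prec f)"
proof -
  have "Poly_Mapping.keys f \<noteq> {}" using assms by simp
  then obtain t where t: "t \<in> Poly_Mapping.keys f" "bounded_by f t"
    using finite_has_greatest[OF finite_keys, of f] by metis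
  with lt_eqI[OF t]
  show "lt prec f \<in> Poly_Mapping.keys f" "bounded_by f (lt prec f)" by simp_all
qed

lemma bounded_by_add:
  "bounded_by f t \<Longrightarrow> bounded_by g t \<Longrightarrow> bounded_by (f + g) t"
  using Poly_Mapping.keys_add[of f g] by blast

lemma bounded_by_diff:
  assumes "bounded_by f t" "bounded_by g t"
  shows "bounded_by (f - g) t"
proof
  fix s assume "s \<in> Poly_Mapping.keys (f - g)"
  then have "s \<in> Poly_Mapping.keys f \<or> s \<in> Poly_Mapping.keys g"
    by (auto simp: in_keys_iff lookup_minus)
  then show "s \<noteq> t \<longrightarrow> prec s t" using assms by blast
qed

text \<open>
  Monomials of a product are products of monomials, and by monotonicity of the order the product of
  the two bounds arises in only one way. Hence leading terms and leading coefficients multiply.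
\<close>

lemma
  fixes f g :: "('v, 'k::field) mpoly"
  assumes f: "bounded_by f s" and g: "bounded_by g t"
  shows bounded_by_mult: "bounded_by (f * g) (s + t)"
    and lookup_mult_bound: "Poly_Mapping.lookup (f * g) (s + t) =
      Poly_Mapping.lookup f s * Poly_Mapping.lookup g t"
proof -
  define c where "c = Poly_Mapping.lookup f s"
  define d where "d = Poly_Mapping.lookup g t"
  define f' where "f' = f - Poly_Mapping.single s c"
  define g' where "g' = g - Poly_Mapping.single t d"
  have add_less: "prec (x + y) (s + t)"
    if "x = s \<and> prec y t \<or> prec x s \<and> y = t \<or> prec x s \<and> prec y t" for x y
  proof -
    have right: "prec (x + t) (s + t)" if "prec x s"
      using prec_add[OF that, of t] by (simp add: add.commute)
    show ?thesis using that right prec_add[of y t x] prec_add[of y t s] prec_trans by blast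
  qed
  have f': "prec x s" if "x \<in> Poly_Mapping.keys f'" for x
    using that f unfolding f'_def c_def
    by (auto simp: in_keys_iff lookup_minus lookup_single when_def split: if_splits)
  have g': "prec x t" if "x \<in> Poly_Mapping.keys g'" for x
    using that g unfolding g'_def d_def
    by (auto simp: in_keys_iff lookup_minus lookup_single when_def split: if_splits)
  define r where "r = Poly_Mapping.single s c * g' + f' * g"
  have prod: "f * g = Poly_Mapping.single (s + t) (c * d) + r"
    unfolding r_def f'_def g'_def by (simp add: algebra_simps mult_single)
  have r: "prec x (s + t)" if x: "x \<in> Poly_Mapping.keys r" for x
  proof -
    consider "x \<in> Poly_Mapping.keys (Poly_Mapping.single s c * g')" | "x \<in> Poly_Mapping.keys (f' * g)"
      using x Poly_Mapping.keys_add[of "Poly_Mapping.single s c * g'" "f' * g"]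
      unfolding r_def by blast
    then show ?thesis
    proof cases
      case 1
      then obtain a b where ab: "x = a + b" "a \<in> Poly_Mapping.keys (Poly_Mapping.single s c)"
        "b \<in> Poly_Mapping.keys g'" using keys_mult by blast
      then have "a = s" by (simp split: if_splits)
      then show ?thesis using ab g' add_less by blast
    next
      case 2
      then obtain a b where "x = a + b" "a \<in> Poly_Mapping.keys f'" "b \<in> Poly_Mapping.keys g"
        using keys_mult by blast
      then show ?thesis using f' g add_less by blast
    qed
  qed
  have "s + t \<notin> Poly_Mapping.keys r" using r prec_irrefl by blast
  then show "Poly_Mapping.lookup (f * g) (s + t) = Poly_Mapping.lookup f s * Poly_Mapping.lookup g t"
    by (simp add: prod lookup_add in_keys_iff c_def d_def)
  show "bounded_by (f * g) (s + t)"
    unfolding prod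
    by (rule bounded_by_add) (use r in \<open>auto split: if_splits\<close>)
qed

definition leading_terms_divisible :: "('v, 'k::field) mpoly set \<Rightarrow> ('v, 'k) mpoly set \<Rightarrow> bool" where
  "leading_terms_divisible F G \<longleftrightarrow>
     (\<forall>f\<in>F. f \<noteq> 0 \<longrightarrow> (\<exists>g\<in>G. g \<noteq> 0 \<and> (\<exists>u. lt prec f = u + lt prec g)))"

lemma leading_terms_divisibleE:
  assumes "leading_terms_divisible F G" "f \<in> F" "f \<noteq> 0"
  obtains g u where "g \<in> G" "g \<noteq> 0" "lt prec f = u + lt prec g"
  using assms unfolding leading_terms_divisible_def by blast

text \<open>
  A monomial lies in a monomial ideal only if a single generator divides it, so equality of initial
  ideals can be tested on one leading term at a time.
\<close>

lemma groebner_basis_iff_divisible: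
  fixes G I :: "('v, 'k::field) mpoly set"
  shows "groebner_basis prec G I \<longleftrightarrow> finite G \<and> G \<subseteq> I \<and> leading_terms_divisible I G"
proof -
  define LT :: "('v, 'k) mpoly set \<Rightarrow> 'v mono set" where "LT F = {lt prec f | f. f \<in> F \<and> f \<noteq> 0}" for F
  have init: "initial_ideal prec F = ideal_gen (monomial ` LT F)" for F :: "('v, 'k) mpoly set"
    unfolding initial_ideal_def LT_def by (rule arg_cong[where f = ideal_gen]) blast
  have "initial_ideal prec G = initial_ideal prec I \<longleftrightarrow> leading_terms_divisible I G" if "G \<subseteq> I"
  proof
    assume eq: "initial_ideal prec G = initial_ideal prec I"
    have "\<exists>g\<in>G. g \<noteq> 0 \<and> (\<exists>u. lt prec f = u + lt prec g)" if "f \<in> I" "f \<noteq> 0" for f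
    proof -
      have "monomial (lt prec f) \<in> initial_ideal prec I"
        unfolding init by (rule ring_module.span_base) (use that in \<open>auto simp: LT_def\<close>)
      then have "monomial (lt prec f) \<in> initial_ideal prec G" by (simp only: eq)
      then show ?thesis
        using keys_in_monomial_ideal[of "monomial (lt prec f) :: ('v, 'k) mpoly" "LT G" "lt prec f"]
        unfolding init by (auto simp: LT_def keys_monomial)
    qed
    then show "leading_terms_divisible I G" unfolding leading_terms_divisible_def by blast
  next
    assume div: "leading_terms_divisible I G"
    show "initial_ideal prec G = initial_ideal prec I"
    proof
      show "initial_ideal prec G \<subseteq> initial_ideal prec I"
        unfolding init by (rule ring_module.span_mono) (use that in \<open>auto simp: LT_def\<close>)
      have "monomial (lt prec f) \<in> initial_ideal prec G" if "f \<in> I" "f \<noteq> 0" for f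
      proof -
        obtain g u where g: "g \<in> G" "g \<noteq> 0" and "lt prec f = u + lt prec g"
          by (rule leading_terms_divisibleE[OF div \<open>f \<in> I\<close> \<open>f \<noteq> 0\<close>])
        moreover have "monomial (lt prec g) \<in> initial_ideal prec G"
          unfolding init by (rule ring_module.span_base) (use g in \<open>auto simp: LT_def\<close>)
        ultimately show ?thesis unfolding init by (simp add: monomial_add ideal_gen_mult)
      qed
      then have "monomial ` LT I \<subseteq> initial_ideal prec G" by (auto simp: LT_def)
      then show "initial_ideal prec I \<subseteq> initial_ideal prec G"
        unfolding init by (metis ring_module.span_mono ring_module.span_span)
    qed
  qed
  then show ?thesis unfolding groebner_basis_def by blast
qed

section \<open>Joining Groebner bases with coprime leading terms\<close>

text \<open>
  This is the descent step. A multiple of \<open>g h\<close> lies in both ideals, and coprimality provides one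
  with leading term \<open>t\<close>. Moving a scalar multiple of it from \<open>a\<close> to \<open>b\<close> keeps the sum and removes
  \<open>t\<close> from \<open>a\<close>; since \<open>t\<close> does not occur in the sum, it disappears from \<open>b\<close> as well.
\<close>

lemma cancel_common_leading_term:
  fixes a b :: "('v, 'k::field) mpoly"
  assumes a: "a \<in> ideal_gen G" "bounded_by a t"
    and b: "b \<in> ideal_gen H" "bounded_by b t"
    and cancel: "Poly_Mapping.lookup (a + b) t = 0"
    and g: "g \<in> G" "g \<noteq> 0" "t = u + lt prec g"
    and h: "h \<in> H" "h \<noteq> 0" "t = v + lt prec h"
    and disj: "Poly_Mapping.keys (lt prec g) \<inter> Poly_Mapping.keys (lt prec h) = {}"
  obtains a' b' where "a' \<in> ideal_gen G" "bounded_by a' t" "b' \<in> ideal_gen H" "bounded_by b' t"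
    "a' + b' = a + b" "Poly_Mapping.lookup a' t = 0" "Poly_Mapping.lookup b' t = 0"
proof -
  obtain w where w: "t = w + (lt prec g + lt prec h)"
    using coprime_monomials_divide[OF g(3) h(3) disj] by blast
  define e where "e = Poly_Mapping.lookup g (lt prec g) * Poly_Mapping.lookup h (lt prec h)"
  have e: "e \<noteq> 0"
    using lt_in_keys[OF g(2)] lt_in_keys[OF h(2)] by (auto simp: e_def in_keys_iff)
  \<comment> \<open>The scalar is chosen so that \<open>q\<close> has the same coefficient as \<open>a\<close> at \<open>t\<close>.\<close>
  define m where "m = Poly_Mapping.single w (Poly_Mapping.lookup a t / e)"
  define q where "q = m * (g * h)"
  have gh: "bounded_by (g * h) (lt prec g + lt prec h)"
    by (rule bounded_by_mult[OF bounded_by_lt[OF g(2)] bounded_by_lt[OF h(2)]])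
  have m: "bounded_by m w" by (simp add: m_def)
  have q_bound: "bounded_by q t"
    unfolding q_def w by (rule bounded_by_mult[OF m gh])
  have "Poly_Mapping.lookup q t = Poly_Mapping.lookup m w * e"
    unfolding q_def w lookup_mult_bound[OF m gh]
    by (simp add: e_def lookup_mult_bound[OF bounded_by_lt[OF g(2)] bounded_by_lt[OF h(2)]])
  then have q_t: "Poly_Mapping.lookup q t = Poly_Mapping.lookup a t"
    using e by (simp add: m_def)
  have qG: "q \<in> ideal_gen G"
    unfolding q_def
    by (rule ideal_gen_mult, rule ideal_gen_mult_right, rule ring_module.span_base, rule g(1))
  have qH: "q \<in> ideal_gen H"
    unfolding q_def
    by (rule ideal_gen_mult, rule ideal_gen_mult, rule ring_module.span_base, rule h(1))
  show ?thesis
  proof (rule that)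
    show "a - q \<in> ideal_gen G" by (rule ring_module.span_diff[OF a(1) qG])
    show "bounded_by (a - q) t" by (rule bounded_by_diff[OF a(2) q_bound])
    show "b + q \<in> ideal_gen H" by (rule ring_module.span_add[OF b(1) qH])
    show "bounded_by (b + q) t" by (rule bounded_by_add[OF b(2) q_bound])
    show "Poly_Mapping.lookup (a - q) t = 0" using q_t by (simp add: lookup_minus)
    show "Poly_Mapping.lookup (b + q) t = 0"
      using cancel q_t by (simp add: lookup_add add.commute)
  qed simp
qed

text \<open>
  The induction runs over an upper bound \<open>t\<close> of the monomials of both summands rather than over the
  greatest of these monomials. A bound that occurs in neither summand is lowered in the same way as
  one that has just been cancelled from both.
\<close>

lemma leading_terms_divisible_Un:
  fixes G H :: "('v, 'k::field) mpoly set"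
  assumes G: "leading_terms_divisible (ideal_gen G) G"
    and H: "leading_terms_divisible (ideal_gen H) H"
    and disj: "\<And>g h. g \<in> G \<Longrightarrow> h \<in> H \<Longrightarrow>
      Poly_Mapping.keys (lt prec g) \<inter> Poly_Mapping.keys (lt prec h) = {}"
  shows "leading_terms_divisible (ideal_gen (G \<union> H)) (G \<union> H)"
proof -
  have descent: "\<exists>g\<in>G \<union> H. g \<noteq> 0 \<and> (\<exists>u. lt prec (a + b) = u + lt prec g)"
    if "a \<in> ideal_gen G" "b \<in> ideal_gen H" "a + b \<noteq> 0" "bounded_by a t" "bounded_by b t" for a b t
    using wf_prec that
  proof (induction t arbitrary: a b rule: wfp_induct_rule)
    case (less t)
    have below: ?case
      if "a' \<in> ideal_gen G" "bounded_by a' t" "b' \<in> ideal_gen H" "bounded_by b' t"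
        "a' + b' = a + b" "Poly_Mapping.lookup a' t = 0" "Poly_Mapping.lookup b' t = 0" for a' b'
    proof -
      let ?K = "Poly_Mapping.keys a' \<union> Poly_Mapping.keys b'"
      have "a' \<noteq> 0 \<or> b' \<noteq> 0" using that(5) less.prems(3) by auto
      then have "?K \<noteq> {}" by simp
      then obtain t' where t': "t' \<in> ?K" "\<forall>s\<in>?K. s \<noteq> t' \<longrightarrow> prec s t'"
        using finite_has_greatest[of ?K] by auto
      have "t' \<noteq> t" using t'(1) that(6,7) by (auto simp: in_keys_iff)
      then have "prec t' t" using t'(1) that(2,4) by blast
      from less.IH[OF this that(1,3)] show ?thesis using t'(2) that(5) less.prems(3) by auto
    qed
    have lt_a: "lt prec a = t" "a \<noteq> 0" if "Poly_Mapping.lookup a t \<noteq> 0"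
      using that less.prems(4) by (auto intro!: lt_eqI simp: in_keys_iff)
    have lt_b: "lt prec b = t" "b \<noteq> 0" if "Poly_Mapping.lookup b t \<noteq> 0"
      using that less.prems(5) by (auto intro!: lt_eqI simp: in_keys_iff)
    have div_a: "\<exists>g\<in>G. g \<noteq> 0 \<and> (\<exists>u. t = u + lt prec g)" if "Poly_Mapping.lookup a t \<noteq> 0"
      using leading_terms_divisibleE[OF G less.prems(1) lt_a(2)[OF that]] lt_a(1)[OF that] by metis
    have div_b: "\<exists>h\<in>H. h \<noteq> 0 \<and> (\<exists>u. t = u + lt prec h)" if "Poly_Mapping.lookup b t \<noteq> 0"
      using leading_terms_divisibleE[OF H less.prems(2) lt_b(2)[OF that]] lt_b(1)[OF that] by metis
    show ?case
    proof (cases "Poly_Mapping.lookup (a + b) t = 0")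
      case False
      have "lt prec (a + b) = t"
        using False by (intro lt_eqI bounded_by_add less.prems(4,5)) (simp add: in_keys_iff)
      moreover have "Poly_Mapping.lookup a t \<noteq> 0 \<or> Poly_Mapping.lookup b t \<noteq> 0"
        using False by (auto simp: lookup_add)
      ultimately show ?thesis using div_a div_b by blast
    next
      case cancel: True
      show ?thesis
      proof (cases "Poly_Mapping.lookup a t = 0")
        case True
        then show ?thesis
          using cancel below[OF less.prems(1,4,2,5) refl] by (simp add: lookup_add)
      next
        case False
        then have "Poly_Mapping.lookup b t \<noteq> 0" using cancel by (auto simp: lookup_add)
        then obtain h v where h: "h \<in> H" "h \<noteq> 0" "t = v + lt prec h" using div_b by blast
        obtain g u where g: "g \<in> G" "g \<noteq> 0" "t = u + lt prec g" using div_a[OF False] by blast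
        obtain a' b' where "a' \<in> ideal_gen G" "bounded_by a' t" "b' \<in> ideal_gen H" "bounded_by b' t"
          "a' + b' = a + b" "Poly_Mapping.lookup a' t = 0" "Poly_Mapping.lookup b' t = 0"
          by (rule cancel_common_leading_term[OF less.prems(1,4,2,5) cancel g h disj[OF g(1) h(1)]])
        then show ?thesis by (rule below)
      qed
    qed
  qed
  have "\<exists>g\<in>G \<union> H. g \<noteq> 0 \<and> (\<exists>u. lt prec f = u + lt prec g)"
    if f: "f \<in> ideal_gen (G \<union> H)" "f \<noteq> 0" for f
  proof -
    obtain a b where ab: "f = a + b" "a \<in> ideal_gen G" "b \<in> ideal_gen H"
      using f(1) unfolding ring_module.span_Un by blast
    let ?K = "Poly_Mapping.keys a \<union> Poly_Mapping.keys b"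
    have "a \<noteq> 0 \<or> b \<noteq> 0" using ab(1) f(2) by auto
    then have "?K \<noteq> {}" by simp
    then obtain t where "\<forall>s\<in>?K. s \<noteq> t \<longrightarrow> prec s t"
      using finite_has_greatest[of ?K] by auto
    then show ?thesis using descent[OF ab(2,3), of t] f(2) ab(1) by simp
  qed
  then show ?thesis unfolding leading_terms_divisible_def by blast
qed

lemma groebner_basis_UN:
  fixes G :: "'i \<Rightarrow> ('v, 'k::field) mpoly set"
  assumes "finite A"
    and "\<And>i. i \<in> A \<Longrightarrow> groebner_basis prec (G i) (ideal_gen (G i))"
    and "\<And>i j g h. i \<in> A \<Longrightarrow> j \<in> A \<Longrightarrow> i \<noteq> j \<Longrightarrow> g \<in> G i \<Longrightarrow> h \<in> G j \<Longrightarrow>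
      Poly_Mapping.keys (lt prec g) \<inter> Poly_Mapping.keys (lt prec h) = {}"
  shows "groebner_basis prec (\<Union>i\<in>A. G i) (ideal_gen (\<Union>i\<in>A. G i))"
  using assms
proof (induction rule: finite_induct)
  case empty
  then show ?case
    by (simp add: groebner_basis_iff_divisible leading_terms_divisible_def)
next
  case (insert j A)
  have A: "groebner_basis prec (\<Union>i\<in>A. G i) (ideal_gen (\<Union>i\<in>A. G i))"
  proof (rule insert.IH)
    fix i i' g h
    assume "i \<in> A" "i' \<in> A" "i \<noteq> i'" "g \<in> G i" "h \<in> G i'"
    then show "Poly_Mapping.keys (lt prec g) \<inter> Poly_Mapping.keys (lt prec h) = {}"
      using insert.prems(2)[of i i' g h] by blast
  qed (use insert.prems(1) in blast)
  have j: "groebner_basis prec (G j) (ideal_gen (G j))"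
    by (rule insert.prems(1)) simp
  have "leading_terms_divisible (ideal_gen (G j \<union> (\<Union>i\<in>A. G i))) (G j \<union> (\<Union>i\<in>A. G i))"
  proof (rule leading_terms_divisible_Un)
    fix g h assume g: "g \<in> G j" and "h \<in> (\<Union>i\<in>A. G i)"
    then obtain i where i: "i \<in> A" "h \<in> G i" by blast
    then have "j \<noteq> i" using insert.hyps(2) by blast
    then show "Poly_Mapping.keys (lt prec g) \<inter> Poly_Mapping.keys (lt prec h) = {}"
      using insert.prems(2)[of j i g h] g i by blast
  qed (use A j in \<open>simp_all add: groebner_basis_iff_divisible\<close>)
  then show ?case
    using A j by (simp add: groebner_basis_iff_divisible ring_module.span_superset)
qed

end

section \<open>Lexicographic orders are term orders\<close>

text \<open>
  Listing the variables from the greatest to the smallest turns \<open>lex_less\<close> into the lexicographic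
  order on exponent lists of a fixed length, which is well-founded.
\<close>

lemma wfp_lex_less:
  fixes gt :: "'v::finite \<Rightarrow> 'v \<Rightarrow> bool"
  assumes irrefl: "\<And>x. \<not> gt x x"
    and trans: "\<And>x y z. gt x y \<Longrightarrow> gt y z \<Longrightarrow> gt x z"
    and total: "\<And>x y. x \<noteq> y \<Longrightarrow> gt x y \<or> gt y x"
  shows "wfp (lex_less gt)"
proof -
  interpret L: linorder "\<lambda>x y. gt x y \<or> x = y" gt
    by unfold_locales (use assms in blast)+
  define xs where "xs = L.sorted_list_of_set (UNIV :: 'v set)"
  have set_xs: "set xs = UNIV" and sorted: "sorted_wrt gt xs"
    by (simp_all add: xs_def)
  define \<phi> where "\<phi> t = map (Poly_Mapping.lookup t) xs" for t :: "'v mono"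
  have "(\<phi> s, \<phi> t) \<in> lexn less_than (length xs)" if less: "lex_less gt s t" for s t
  proof -
    obtain x where x: "Poly_Mapping.lookup s x < Poly_Mapping.lookup t x"
      "\<And>y. gt y x \<Longrightarrow> Poly_Mapping.lookup s y = Poly_Mapping.lookup t y"
      using less unfolding lex_less_def by blast
    have "x \<in> set xs" using set_xs by simp
    then obtain ys zs where split: "xs = ys @ x # zs" by (meson split_list)
    have "\<forall>y\<in>set ys. gt y x" using sorted unfolding split by (auto simp: sorted_wrt_append)
    then have "\<phi> t = map (Poly_Mapping.lookup s) ys @ Poly_Mapping.lookup t x #
        map (Poly_Mapping.lookup t) zs"
      using x(2) by (auto simp: \<phi>_def split)
    moreover have "\<phi> s = map (Poly_Mapping.lookup s) ys @ Poly_Mapping.lookup s x #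
        map (Poly_Mapping.lookup s) zs"
      by (simp add: \<phi>_def split)
    ultimately show ?thesis
      using x(1) by (auto simp: lexn_conv split)
  qed
  then have "{(s, t). lex_less gt s t} \<subseteq> inv_image (lexn less_than (length xs)) \<phi>" by auto
  moreover have "wf (inv_image (lexn less_than (length xs)) \<phi>)"
    by (intro wf_inv_image wf_lexn wf_less_than)
  ultimately show ?thesis unfolding wfp_def by (rule wf_subset[rotated])
qed

lemma term_order_lex_less:
  fixes gt :: "'v::finite \<Rightarrow> 'v \<Rightarrow> bool"
  assumes irrefl: "\<And>x. \<not> gt x x"
    and trans: "\<And>x y z. gt x y \<Longrightarrow> gt y z \<Longrightarrow> gt x z"
    and total: "\<And>x y. x \<noteq> y \<Longrightarrow> gt x y \<or> gt y x"
  shows "term_order (lex_less gt)"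
proof
  show "wfp (lex_less gt)" by (rule wfp_lex_less[OF assms])
  interpret L: linorder "\<lambda>x y. gt x y \<or> x = y" gt
    by unfold_locales (use assms in blast)+
  fix s t u :: "'v mono"
  show "lex_less gt s u" if st: "lex_less gt s t" and tu: "lex_less gt t u"
  proof -
    obtain x where x: "Poly_Mapping.lookup s x < Poly_Mapping.lookup t x"
      "\<And>y. gt y x \<Longrightarrow> Poly_Mapping.lookup s y = Poly_Mapping.lookup t y"
      using st unfolding lex_less_def by blast
    obtain z where z: "Poly_Mapping.lookup t z < Poly_Mapping.lookup u z"
      "\<And>y. gt y z \<Longrightarrow> Poly_Mapping.lookup t y = Poly_Mapping.lookup u y"
      using tu unfolding lex_less_def by blast
    consider "gt x z" | "gt z x" | "x = z" using total by blast
    then show ?thesis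
    proof cases
      case 1
      then show ?thesis unfolding lex_less_def using x z trans by (metis (no_types))
    next
      case 2
      then show ?thesis unfolding lex_less_def using x z trans by (metis (no_types))
    next
      case 3
      then show ?thesis unfolding lex_less_def using x z by (metis less_trans)
    qed
  qed
  show "lex_less gt s t \<or> lex_less gt t s" if "s \<noteq> t"
  proof -
    let ?D = "{x. Poly_Mapping.lookup s x \<noteq> Poly_Mapping.lookup t x}"
    have "?D \<noteq> {}" using that by (auto intro: poly_mapping_eqI)
    \<comment> \<open>In \<open>L\<close> the greater variables come first, so this is the greatest variable in \<open>?D\<close>.\<close>
    then have "L.Min ?D \<in> ?D" "\<And>y. y \<in> ?D \<Longrightarrow> gt (L.Min ?D) y \<or> L.Min ?D = y"
      using L.Min_in[of ?D] L.Min_le[of ?D] by auto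
    then obtain x where x: "x \<in> ?D" "\<And>y. y \<in> ?D \<Longrightarrow> gt x y \<or> x = y" by blast
    then have eq: "Poly_Mapping.lookup s y = Poly_Mapping.lookup t y" if "gt y x" for y
      using that irrefl trans by blast
    show ?thesis
      using x(1) eq unfolding lex_less_def by (metis (mono_tags, lifting) linorder_neqE mem_Collect_eq)
  qed
  show "lex_less gt (u + s) (u + t)" if "lex_less gt s t"
    using that unfolding lex_less_def by (simp add: lookup_add)
qed

lemma term_order_scan_less:
  "term_order (scan_less s :: ('m::{finite,linorder} \<times> 'n::{finite,linorder}) mono \<Rightarrow> _)"
  by (rule term_order_lex_less; cases s) auto

section \<open>Blockwise determinantal ideals\<close>

theorem proposition3p3:
  fixes k :: nat
    and B :: "nat \<Rightarrow> ('m::{finite,linorder} \<times> 'n::{finite,linorder}) set"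
    and r :: "nat \<Rightarrow> nat"
    and s :: scan
    and G :: "nat \<Rightarrow> ('m \<times> 'n, 'k::field) mpoly set"
  assumes "CARD('m) \<le> CARD('n)"
    and "\<And>i. i \<in> {1..k} \<Longrightarrow> diagonal (B i)"
    and "\<And>i. i \<in> {1..k} \<Longrightarrow> r i > 0"
    and "\<And>i. i \<in> {1..k} \<Longrightarrow> G i = minors_in (r i) (B i)"
    and known: "\<And>i. i \<in> {1..k} \<Longrightarrow> groebner_basis (scan_less s) (G i) (ideal_gen (G i))"
    and "\<And>i j g h. i \<in> {1..k} \<Longrightarrow> j \<in> {1..k} \<Longrightarrow> i \<noteq> j \<Longrightarrow> g \<in> G i \<Longrightarrow> h \<in> G j \<Longrightarrow>
           Poly_Mapping.keys (lt (scan_less s) g) \<inter> Poly_Mapping.keys (lt (scan_less s) h) = {}"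
  shows "groebner_basis (scan_less s) (\<Union>i\<in>{1..k}. G i) (blockwise_ideal k B r)"
proof -
  interpret term_order "scan_less s :: ('m \<times> 'n) mono \<Rightarrow> _"
    by (rule term_order_scan_less)
  have "blockwise_ideal k B r = ideal_gen (\<Union>i\<in>{1..k}. G i)"
    using assms(4) by (simp add: blockwise_ideal_def)
  then show ?thesis
    using groebner_basis_UN[of "{1..k}" G] known assms(6) by simp
qed

end
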